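(* Let $X$ be the $1$-dimensional abstract simplicial complex corresponding to a graph $G=(V,E)$, i.e. the complex whose $0$-simplices correspond to $V$ and whose $1$-simplices correspond to $E$. Then for each vertex $v$, $$\beta_1(\operatorname{star}[v])=\dim H_1\big(X,X\setminus\operatorname{star}[v]\big)=\deg v-1 .$$
   Context: Graphs are undirected and simple; $\deg v=|\{w\in V:(v,w)\in E\}|$, and $[v]$ is the $0$-simplex of $v$. An abstract simplicial complex $X$ with vertices in a countable set is a collection of nonempty finite subsets (simplices, or faces) closed under taking nonempty subsets; a simplex $\sigma$ has dimension $|\sigma|-1$. Complexes are assumed locally finite: the star $\operatorname{star}\sigma=\{\tau\in X:\sigma\subseteq\tau\}$ of every simplex is a finite set (so all vertex degrees are finite). For a subcomplex $Y\subseteq X$, $C_k(X,Y)$ ($k\ge 0$) is the real vector space with basis the $k$-dimensional simplices of $X$ not in $Y$; with vertices listed in a fixed total order, the boundary map $\partial_k:C_k(X,Y)\to C_{k-1}(X,Y)$ is $\partial_k[v_0,\dots,v_k]=\sum_{i=0}^k(-1)^i[v_0,\dots,\widehat{v_i},\dots,v_k]$, with terms lying in $Y$ replaced by $0$ and $\partial_0=0$. $H_k(X,Y)$ is the homology of this chain complex, and "dim" is dimension over $\mathbb{R}$.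
   Formalization: The vertex v is assumed to have degree at least 1; for an isolated vertex the stated formula is false, since the relative homology H_1 has dimension 0 while deg v − 1 = −1. *)

theory Defs
  imports
    "HOL-Analysis.Finite_Function_Topology"
    "HOL-Algebra.AbelCoset"
    "Jordan_Normal_Form.VS_Connect"
begin

section \<open>Abstract simplicial complexes\<close>

definition simplicial_complex :: "'a set set \<Rightarrow> bool" where
  "simplicial_complex X \<longleftrightarrow>
     countable (\<Union>X) \<and>
     (\<forall>\<sigma>\<in>X. finite \<sigma> \<and> \<sigma> \<noteq> {} \<and> (\<forall>\<tau>. \<tau> \<subseteq> \<sigma> \<and> \<tau> \<noteq> {} \<longrightarrow> \<tau> \<in> X))"

definition star :: "'a set set \<Rightarrow> 'a set \<Rightarrow> 'a set set" where
  "star X \<sigma> = {\<tau> \<in> X. \<sigma> \<subseteq> \<tau>}"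

definition locally_finite_complex :: "'a set set \<Rightarrow> bool" where
  "locally_finite_complex X \<longleftrightarrow> simplicial_complex X \<and> (\<forall>\<sigma>\<in>X. finite (star X \<sigma>))"

lemma simplicial_complex_diff_star:
  assumes "simplicial_complex X"
  shows "simplicial_complex (X - star X \<sigma>)"
proof -
  have "countable (\<Union>(X - star X \<sigma>))"
    using assms unfolding simplicial_complex_def by (meson Diff_subset Union_mono countable_subset)
  then show ?thesis
    using assms unfolding simplicial_complex_def star_def by auto
qed


section \<open>Relative simplicial homology with real coefficients\<close>

text \<open>
  A real chain is a finitely supported function on finite vertex sets, of type
  \<open>'a set \<Rightarrow>\<^sub>0 real\<close>. The fixed total order on the vertices is the order of the type \<open>'a\<close>.
  The fields \<open>mult\<close> and \<open>one\<close> of a module record play no role in a vector space.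
\<close>

definition simplices :: "'a set set \<Rightarrow> nat \<Rightarrow> 'a set set" where
  "simplices X k = {\<sigma> \<in> X. card \<sigma> = k + 1}"

definition chain_space ::
    "'a set set \<Rightarrow> 'a set set \<Rightarrow> nat \<Rightarrow> (real, 'a set \<Rightarrow>\<^sub>0 real) module" where
  "chain_space X Y k =
     \<lparr>carrier = {c. Poly_Mapping.keys c \<subseteq> simplices X k - Y},
      mult = undefined, one = undefined,
      zero = 0, add = (+), smult = scaleR\<rparr>"

text \<open>The face of \<open>\<sigma> = [v\<^sub>0,\<dots>,v\<^sub>k]\<close>, \<open>v\<^sub>0 < \<dots> < v\<^sub>k\<close>, opposite to \<open>v\<^sub>i\<close>.\<close>

definition face :: "'a::linorder set \<Rightarrow> nat \<Rightarrow> 'a set" where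
  "face \<sigma> i = \<sigma> - {sorted_list_of_set \<sigma> ! i}"

definition boundary ::
    "'a::linorder set set \<Rightarrow> nat \<Rightarrow> ('a set \<Rightarrow>\<^sub>0 real) \<Rightarrow> ('a set \<Rightarrow>\<^sub>0 real)" where
  "boundary Y k c =
     (if k = 0 then 0
      else \<Sum>\<sigma>\<in>Poly_Mapping.keys c. Poly_Mapping.lookup c \<sigma> *\<^sub>R
             (\<Sum>i\<le>k. if face \<sigma> i \<in> Y then 0 else Poly_Mapping.single (face \<sigma> i) ((-1) ^ i)))"

definition cycles :: "'a::linorder set set \<Rightarrow> 'a set set \<Rightarrow> nat \<Rightarrow> ('a set \<Rightarrow>\<^sub>0 real) set" where
  "cycles X Y k = {c \<in> carrier (chain_space X Y k). boundary Y k c = 0}"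

definition boundaries :: "'a::linorder set set \<Rightarrow> 'a set set \<Rightarrow> nat \<Rightarrow> ('a set \<Rightarrow>\<^sub>0 real) set" where
  "boundaries X Y k = boundary Y (k + 1) ` carrier (chain_space X Y (k + 1))"

definition quotient_space :: "('r, 'v) module \<Rightarrow> 'v set \<Rightarrow> ('r, 'v set) module" where
  "quotient_space V W =
     \<lparr>carrier = a_rcosets\<^bsub>V\<^esub> W,
      mult = undefined, one = undefined,
      zero = W, add = set_add V,
      smult = (\<lambda>r A. \<Union>a\<in>A. W +>\<^bsub>V\<^esub> (r \<odot>\<^bsub>V\<^esub> a))\<rparr>"

definition homology ::
    "'a::linorder set set \<Rightarrow> 'a set set \<Rightarrow> nat \<Rightarrow> (real, ('a set \<Rightarrow>\<^sub>0 real) set) module" where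
  "homology X Y k =
     quotient_space ((chain_space X Y k)\<lparr>carrier := cycles X Y k\<rparr>) (boundaries X Y k)"

text \<open>
  \<open>class_ring :: real ring\<close> is the field of real numbers as a record. The dimension is only
  meaningful for finite-dimensional spaces.
\<close>

definition real_dim :: "(real, 'v) module \<Rightarrow> nat" where
  "real_dim V = vectorspace.dim class_ring V"

text \<open>The Betti number of a set \<open>S\<close> of simplices whose complement is a subcomplex, such as a star.\<close>

definition local_betti :: "'a::linorder set set \<Rightarrow> nat \<Rightarrow> 'a set set \<Rightarrow> nat" where
  "local_betti X k S = real_dim (homology X (X - S) k)"


section \<open>Graphs\<close>

definition simple_graph :: "'a set \<Rightarrow> ('a \<times> 'a) set \<Rightarrow> bool" where
  "simple_graph V E \<longleftrightarrow> E \<subseteq> V \<times> V \<and> sym E \<and> irrefl E"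

definition vertex_degree :: "'a set \<Rightarrow> ('a \<times> 'a) set \<Rightarrow> 'a \<Rightarrow> nat" where
  "vertex_degree V E v = card {w \<in> V. (v, w) \<in> E}"

definition graph_complex :: "'a set \<Rightarrow> ('a \<times> 'a) set \<Rightarrow> 'a set set" where
  "graph_complex V E = {{v} | v. v \<in> V} \<union> {{v, w} | v w. (v, w) \<in> E}"

lemma simplicial_complex_graph_complex:
  assumes "simple_graph V E" "countable V"
  shows "simplicial_complex (graph_complex V E)"
proof -
  have "\<Union>(graph_complex V E) \<subseteq> V"
    using assms(1) unfolding simple_graph_def graph_complex_def by auto
  then have "countable (\<Union>(graph_complex V E))"
    using assms(2) countable_subset by blast
  moreover have "\<tau> \<in> graph_complex V E"
    if \<sigma>: "\<sigma> \<in> graph_complex V E" and \<tau>: "\<tau> \<subseteq> \<sigma>" "\<tau> \<noteq> {}" for \<sigma> \<tau>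
  proof -
    consider (vertex) v where "v \<in> V" "\<sigma> = {v}" | (edge) v w where "(v, w) \<in> E" "\<sigma> = {v, w}"
      using \<sigma> unfolding graph_complex_def by blast
    then show ?thesis
    proof cases
      case vertex
      then have "\<tau> = \<sigma>" using \<tau> by blast
      then show ?thesis using \<sigma> by simp
    next
      case edge
      then have "v \<in> V" "w \<in> V" using assms(1) unfolding simple_graph_def by blast+
      moreover have "\<tau> = {v} \<or> \<tau> = {w} \<or> \<tau> = \<sigma>" using edge(2) \<tau> by blast
      ultimately show ?thesis using \<sigma> unfolding graph_complex_def by blast
    qed
  qed
  moreover have "finite \<sigma> \<and> \<sigma> \<noteq> {}" if "\<sigma> \<in> graph_complex V E" for \<sigma>
    using that unfolding graph_complex_def by auto
  ultimately show ?thesis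
    unfolding simplicial_complex_def by blast
qed

end

theory Submission
  imports Defs
begin

text \<open>
  Write \<open>Y = X - star X {v}\<close>. This subcomplex contains every vertex other than \<open>v\<close> and every
  edge that avoids \<open>v\<close>, so the relative chain complex of \<open>(X, Y)\<close> is concentrated in degrees
  0 and 1: \<open>C\<^sub>0\<close> is the line spanned by \<open>v\<close>, and \<open>C\<^sub>1\<close> has the edges at \<open>v\<close> as a basis, hence
  dimension \<open>deg v\<close>. An edge \<open>{v, w}\<close> has boundary \<open>\<plusminus>v\<close>, because its other endpoint \<open>w\<close> lies
  in \<open>Y\<close> (\<open>boundary_edge_relative\<close>). As \<open>v\<close> has a neighbour, the boundary map \<open>C\<^sub>1 \<rightarrow> C\<^sub>0\<close>
  is onto, and rank-nullity gives \<open>deg v - 1\<close> for the dimension of the space of 1-cycles.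
  There are no 2-simplices, so no nonzero boundaries, and \<open>H\<^sub>1\<close> is this space of cycles.

  The linear algebra is that of module records with explicit carriers. Three facts connect it
  with chains: a chain space has its simplices as a basis (\<open>dim_chain_space\<close>), the
  boundary is a linear map of chain spaces (\<open>linear_map_boundary\<close>), and a quotient by the zero
  subspace, formally a space of singleton cosets, keeps the dimension
  (\<open>quotient_by_zero_space\<close>). The lemma \<open>dim_top_homology\<close> combines them into a dimension count
  in the top degree of a pair with finitely many relative simplices in the top two degrees,
  under the condition that the top boundary map is onto.
\<close>

section \<open>Real vector spaces as module records\<close>

text \<open>
  Chains have a type of class \<open>real_vector\<close>, while homology is a module record. The next two
  lemmas reduce the record's axioms and its finite sums to those of the type.
\<close>

lemma vectorspace_real_carrier:
  fixes M :: "(real, 'b::real_vector, 'm) module_scheme"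
  assumes ops: "zero M = 0" "add M = (+)" "smult M = scaleR"
    and sub: "Real_Vector_Spaces.subspace (carrier M)"
  shows "vectorspace class_ring M"
proof (rule vs_criteria)
  show "Ring.field (class_ring :: real ring)"
    by (rule class_field.field_axioms)
  show "\<forall>v\<in>carrier M. \<exists>w\<in>carrier M. v \<oplus>\<^bsub>M\<^esub> w = \<zero>\<^bsub>M\<^esub>"
    using sub real_vector.subspace_neg[OF sub] by (auto simp: ops intro!: bexI[of _ "- _"])
qed (use sub in \<open>auto simp: ops real_vector.subspace_def algebra_simps\<close>)

lemma finsum_real_carrier:
  fixes M :: "(real, 'b::real_vector, 'm) module_scheme"
  assumes ops: "zero M = 0" "add M = (+)" "smult M = scaleR"
    and sub: "Real_Vector_Spaces.subspace (carrier M)"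
    and f: "f \<in> A \<rightarrow> carrier M"
  shows "finsum M f A = sum f A"
proof -
  interpret vectorspace class_ring M
    using ops sub by (rule vectorspace_real_carrier)
  show ?thesis
    using f by (induction A rule: infinite_finite_induct) (auto simp: ops)
qed

text \<open>
  Independence in \<open>W\<close> is independence in \<open>V\<close>, so the dimension of \<open>V\<close> bounds the size of independent
  subsets of \<open>W\<close>; one that is maximal is a finite basis of \<open>W\<close>.
\<close>

lemma (in vectorspace) fin_dim_subspace:
  assumes W: "VectorSpace.subspace K W V" and fd: "fin_dim"
  shows "vectorspace.fin_dim K (vs W)"
proof -
  interpret W: vectorspace K "vs W"
    using W by (rule subspace_is_vs)
  have sub: "submodule K W V" and WV: "W \<subseteq> carrier V"
    using W by (auto simp: VectorSpace.subspace_def submodule_def)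
  have "finite A \<and> card A \<le> dim" if "A \<subseteq> W \<and> W.lin_indpt A" for A
    using li_le_dim[OF fd, of A] that WV span_li_not_depend(2)[of A W] sub by auto
  moreover have "{} \<subseteq> W \<and> W.lin_indpt {}"
    by (simp add: W.lin_dep_def)
  ultimately obtain A where "finite A" and max: "maximal A (\<lambda>S. S \<subseteq> W \<and> W.lin_indpt S)"
    using maximal_exists[of "\<lambda>S. S \<subseteq> W \<and> W.lin_indpt S" dim "{}"] by blast
  moreover have "W.basis A"
    using max by (intro W.max_li_is_basis) simp
  ultimately show ?thesis
    by (auto simp: W.fin_dim_def W.basis_def)
qed

text \<open>
  The cosets of the zero subspace are the singletons, and \<open>a \<mapsto> {a}\<close> is a linear isomorphism onto
  the quotient. That the quotient is a vector space is read off along the same bijection.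
\<close>

lemma quotient_by_zero_space:
  fixes V :: "('r, 'v) module"
  assumes V: "vectorspace K V" and fd: "vectorspace.fin_dim K V"
  shows "vectorspace.dim K (quotient_space V {\<zero>\<^bsub>V\<^esub>}) = vectorspace.dim K V"
proof -
  interpret V: vectorspace K V
    by (rule V)
  define Q where "Q = quotient_space V {\<zero>\<^bsub>V\<^esub>}"
  have coset: "{\<zero>\<^bsub>V\<^esub>} +>\<^bsub>V\<^esub> a = {a}" if "a \<in> carrier V" for a
    using that by (simp add: a_r_coset_def')
  have carrier: "carrier Q = (\<lambda>a. {a}) ` carrier V"
  proof -
    have "carrier Q = (\<lambda>a. {\<zero>\<^bsub>V\<^esub>} +>\<^bsub>V\<^esub> a) ` carrier V"
      by (auto simp: Q_def quotient_space_def A_RCOSETS_def')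
    also have "\<dots> = (\<lambda>a. {a}) ` carrier V"
      using coset by (rule image_cong[OF refl])
    finally show ?thesis .
  qed
  have ops: "\<zero>\<^bsub>Q\<^esub> = {\<zero>\<^bsub>V\<^esub>}" "\<And>a b. {a} \<oplus>\<^bsub>Q\<^esub> {b} = {a \<oplus>\<^bsub>V\<^esub> b}"
    "\<And>r a. r \<in> carrier K \<Longrightarrow> a \<in> carrier V \<Longrightarrow> r \<odot>\<^bsub>Q\<^esub> {a} = {r \<odot>\<^bsub>V\<^esub> a}"
    by (simp_all add: Q_def quotient_space_def set_add_def' coset)
  have Q: "vectorspace K Q"
  proof (rule vs_criteria)
    show "\<forall>A\<in>carrier Q. \<exists>B\<in>carrier Q. A \<oplus>\<^bsub>Q\<^esub> B = \<zero>\<^bsub>Q\<^esub>"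
      using V.M.r_neg by (fastforce simp: carrier ops)
  qed (auto simp: carrier ops V.field_axioms V.M.a_ac V.smult_l_distr V.smult_r_distr
      V.smult_assoc1)
  interpret T: linear_map K V Q "\<lambda>a. {a}"
  proof (intro linear_map.intro mod_hom.intro mod_hom_axioms.intro)
    show "module K Q"
      using Q by (simp add: vectorspace_def)
  qed (auto simp: V V.module_axioms Q module_hom_def carrier ops)
  show ?thesis
    unfolding Q_def[symmetric] using T.dim_eq[OF fd] by (simp add: carrier inj_on_def)
qed

section \<open>Chain spaces\<close>

lemma lookup_scaleR_poly_mapping:
  fixes c :: "'b \<Rightarrow>\<^sub>0 real"
  shows "Poly_Mapping.lookup (r *\<^sub>R c) x = r *\<^sub>R Poly_Mapping.lookup c x"
  by (simp add: scaleR_poly_mapping_def)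

lemma chain_space_ops [simp]:
  "zero (chain_space X Y k) = 0"
  "add (chain_space X Y k) = (+)"
  "smult (chain_space X Y k) = scaleR"
  by (simp_all add: chain_space_def)

lemma carrier_chain_space:
  "c \<in> carrier (chain_space X Y k) \<longleftrightarrow> Poly_Mapping.keys c \<subseteq> simplices X k - Y"
  by (simp add: chain_space_def)

lemma subspace_chain_space:
  "Real_Vector_Spaces.subspace (carrier (chain_space X Y k))"
proof -
  have "Poly_Mapping.keys (r *\<^sub>R c) \<subseteq> Poly_Mapping.keys c" for r and c :: "'a set \<Rightarrow>\<^sub>0 real"
    by (auto simp: in_keys_iff lookup_scaleR_poly_mapping)
  then show ?thesis
    using Poly_Mapping.keys_add
    by (fastforce simp: real_vector.subspace_def carrier_chain_space)
qed

lemma vectorspace_chain_space: "vectorspace class_ring (chain_space X Y k)"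
  by (simp add: vectorspace_real_carrier subspace_chain_space)

lemma poly_mapping_sum_single:
  fixes c :: "'b \<Rightarrow>\<^sub>0 real"
  assumes "finite A" "Poly_Mapping.keys c \<subseteq> A"
  shows "(\<Sum>x\<in>A. Poly_Mapping.lookup c x *\<^sub>R Poly_Mapping.single x 1) = c"
proof (rule poly_mapping_eqI)
  fix y
  show "Poly_Mapping.lookup (\<Sum>x\<in>A. Poly_Mapping.lookup c x *\<^sub>R Poly_Mapping.single x 1) y
      = Poly_Mapping.lookup c y"
    using assms
    by (auto simp: lookup_sum lookup_scaleR_poly_mapping lookup_single when_def if_distrib
        in_keys_iff sum.delta cong: if_cong)
qed

text \<open>
  The indicator chains \<open>e \<sigma>\<close> of the simplices outside \<open>Y\<close> form a basis: the value of a chain at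
  \<open>\<sigma>\<close> is its coordinate along \<open>e \<sigma>\<close>, which gives both existence and uniqueness of coordinates.
\<close>

lemma dim_chain_space:
  fixes X Y :: "'a set set"
  assumes fin: "finite (simplices X k - Y)"
  shows "vectorspace.fin_dim class_ring (chain_space X Y k)"
    and "real_dim (chain_space X Y k) = card (simplices X k - Y)"
proof -
  define A where "A = simplices X k - Y"
  define e :: "'a set \<Rightarrow> 'a set \<Rightarrow>\<^sub>0 real" where "e \<sigma> = Poly_Mapping.single \<sigma> 1" for \<sigma>
  interpret C: vectorspace class_ring "chain_space X Y k"
    by (rule vectorspace_chain_space)
  have inj: "inj e"
    by (metis (no_types, lifting) e_def injI keys_single singleton_inject zero_neq_one)
  have inC: "e ` A \<subseteq> carrier (chain_space X Y k)"
    by (auto simp: carrier_chain_space e_def A_def)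
  have finA: "finite (e ` A)"
    using fin by (simp add: A_def)
  have lincomb: "C.lincomb a (e ` A) = (\<Sum>\<sigma>\<in>A. a (e \<sigma>) *\<^sub>R e \<sigma>)" for a
  proof -
    have "C.lincomb a (e ` A) = (\<Sum>b\<in>e ` A. a b *\<^sub>R b)"
      unfolding C.lincomb_def chain_space_ops
      using inC
      by (intro finsum_real_carrier)
        (auto simp: subspace_chain_space intro!: real_vector.subspace_scale[OF subspace_chain_space])
    also have "\<dots> = (\<Sum>\<sigma>\<in>A. a (e \<sigma>) *\<^sub>R e \<sigma>)"
      using inj by (simp add: sum.reindex inj_on_subset[OF inj])
    finally show ?thesis .
  qed
  have "C.gen_set (e ` A)"
  proof
    show "C.span (e ` A) \<subseteq> carrier (chain_space X Y k)"
      using inC by (rule C.span_is_subset2)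
    show "carrier (chain_space X Y k) \<subseteq> C.span (e ` A)"
    proof
      fix c assume "c \<in> carrier (chain_space X Y k)"
      then have "c = (\<Sum>\<sigma>\<in>A. Poly_Mapping.lookup c \<sigma> *\<^sub>R e \<sigma>)"
        using fin by (simp add: poly_mapping_sum_single carrier_chain_space A_def e_def)
      also have "\<dots> = C.lincomb (\<lambda>b. Poly_Mapping.lookup c (inv_into UNIV e b)) (e ` A)"
        by (simp add: lincomb inv_f_f[OF inj])
      finally show "c \<in> C.span (e ` A)"
        using finA inC by (auto simp: C.finite_span)
    qed
  qed
  moreover have "C.lin_indpt (e ` A)"
  proof (rule C.finite_lin_indpt2[OF finA inC])
    fix a :: "('a set \<Rightarrow>\<^sub>0 real) \<Rightarrow> real"
    assume "C.lincomb a (e ` A) = \<zero>\<^bsub>chain_space X Y k\<^esub>"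
    then have 0: "(\<Sum>\<sigma>\<in>A. a (e \<sigma>) *\<^sub>R e \<sigma>) = 0"
      by (simp add: lincomb)
    have "a (e \<tau>) = 0" if "\<tau> \<in> A" for \<tau>
    proof -
      have "a (e \<tau>) = Poly_Mapping.lookup (\<Sum>\<sigma>\<in>A. a (e \<sigma>) *\<^sub>R e \<sigma>) \<tau>"
        using that fin
        by (simp add: lookup_sum lookup_scaleR_poly_mapping e_def lookup_single when_def A_def
            if_distrib sum.delta cong: if_cong)
      then show ?thesis
        by (simp add: 0)
    qed
    then show "\<forall>b\<in>e ` A. a b = \<zero>\<^bsub>class_ring\<^esub>"
      by simp
  qed
  ultimately have basis: "C.basis (e ` A)"
    using inC by (simp add: C.basis_def)
  then show "C.fin_dim"
    using finA by (auto simp: C.fin_dim_def C.basis_def)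
  show "real_dim (chain_space X Y k) = card (simplices X k - Y)"
    using C.dim_basis[OF finA basis] inj
    by (simp add: real_dim_def card_image inj_on_subset[OF inj] A_def)
qed

section \<open>The boundary map\<close>

lemma face_in_simplices:
  assumes X: "simplicial_complex X" and \<sigma>: "\<sigma> \<in> simplices X (Suc k)" and i: "i \<le> Suc k"
  shows "face \<sigma> i \<in> simplices X k"
proof -
  have fin: "finite \<sigma>" and card: "card \<sigma> = Suc (Suc k)" and "\<sigma> \<in> X"
    using X \<sigma> by (auto simp: simplices_def simplicial_complex_def)
  have "sorted_list_of_set \<sigma> ! i \<in> \<sigma>"
    using fin card i by (metis le_imp_less_Suc length_sorted_list_of_set nth_mem set_sorted_list_of_set)
  then have c: "card (face \<sigma> i) = k + 1"
    using card by (simp add: face_def)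
  then have "face \<sigma> i \<noteq> {}"
    by auto
  moreover have "face \<sigma> i \<subseteq> \<sigma>"
    by (auto simp: face_def)
  ultimately have "face \<sigma> i \<in> X"
    using X \<open>\<sigma> \<in> X\<close> unfolding simplicial_complex_def by blast
  with c show ?thesis
    by (simp add: simplices_def)
qed

text \<open>
  The defining sum of the boundary runs over the support of the chain, which varies with the
  chain. Summing over a fixed finite set that contains all supports involved makes the
  linearity of the boundary visible.
\<close>

lemma boundary_eq_sum_superset:
  assumes "finite A" "Poly_Mapping.keys c \<subseteq> A" "k \<noteq> 0"
  shows "boundary Y k c = (\<Sum>\<sigma>\<in>A. Poly_Mapping.lookup c \<sigma> *\<^sub>R
    (\<Sum>i\<le>k. if face \<sigma> i \<in> Y then 0 else Poly_Mapping.single (face \<sigma> i) ((-1) ^ i)))"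
  unfolding boundary_def using assms
  by (auto simp: in_keys_iff intro!: sum.mono_neutral_left)

lemma boundary_add: "boundary Y k (c + d) = boundary Y k c + boundary Y k d"
proof (cases "k = 0")
  case False
  let ?A = "Poly_Mapping.keys c \<union> Poly_Mapping.keys d"
  have "Poly_Mapping.keys (c + d) \<subseteq> ?A"
    by (rule Poly_Mapping.keys_add)
  then show ?thesis
    using False
    by (simp add: boundary_eq_sum_superset[of ?A] lookup_add scaleR_add_left sum.distrib)
qed (simp add: boundary_def)

lemma boundary_scaleR: "boundary Y k (r *\<^sub>R c) = r *\<^sub>R boundary Y k c"
proof (cases "k = 0")
  case False
  have "Poly_Mapping.keys (r *\<^sub>R c) \<subseteq> Poly_Mapping.keys c"
    by (auto simp: in_keys_iff lookup_scaleR_poly_mapping)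
  then show ?thesis
    using False
    by (simp add: boundary_eq_sum_superset[of "Poly_Mapping.keys c"] lookup_scaleR_poly_mapping
        scaleR_sum_right)
qed (simp add: boundary_def)

lemma boundary_single:
  assumes "k \<noteq> 0"
  shows "boundary Y k (Poly_Mapping.single \<sigma> r) = r *\<^sub>R
    (\<Sum>i\<le>k. if face \<sigma> i \<in> Y then 0 else Poly_Mapping.single (face \<sigma> i) ((-1) ^ i))"
  using assms by (subst boundary_eq_sum_superset[of "{\<sigma>}"]) auto

lemma boundary_in_chain_space:
  assumes X: "simplicial_complex X" and c: "c \<in> carrier (chain_space X Y (Suc k))"
  shows "boundary Y (Suc k) c \<in> carrier (chain_space X Y k)"
proof -
  note sub = subspace_chain_space[of X Y k]
  have "(if face \<sigma> i \<in> Y then 0 else Poly_Mapping.single (face \<sigma> i) ((-1) ^ i))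
      \<in> carrier (chain_space X Y k)"
    if "\<sigma> \<in> Poly_Mapping.keys c" "i \<le> Suc k" for \<sigma> i
    using face_in_simplices[OF X _ that(2), of \<sigma>] that c
    by (auto simp: carrier_chain_space)
  then show ?thesis
    unfolding boundary_def if_not_P[OF nat.distinct(2)]
    by (intro real_vector.subspace_sum[OF sub] real_vector.subspace_scale[OF sub]) simp_all
qed

lemma linear_map_boundary:
  assumes "simplicial_complex X"
  shows "linear_map class_ring (chain_space X Y (Suc k)) (chain_space X Y k) (boundary Y (Suc k))"
proof (intro linear_map.intro mod_hom.intro mod_hom_axioms.intro)
  show "boundary Y (Suc k)
      \<in> module_hom class_ring (chain_space X Y (Suc k)) (chain_space X Y k)"
    using boundary_in_chain_space[OF assms]
    by (simp add: module_hom_def boundary_add boundary_scaleR)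
qed (rule vectorspace_chain_space vectorspace.axioms(1)[OF vectorspace_chain_space])+

section \<open>Relative homology in top degree\<close>

text \<open>
  Without relative simplices of dimension \<open>k + 2\<close> the boundaries in degree \<open>k + 1\<close> vanish, so the
  homology there is the kernel of the boundary map; rank-nullity computes its dimension when
  that map is onto, i.e. has rank \<open>dim C\<^sub>k\<close>. The equation is additive to avoid
  truncated subtraction.
\<close>

lemma dim_top_homology:
  assumes X: "simplicial_complex X"
    and top: "simplices X (Suc (Suc k)) \<subseteq> Y"
    and fin: "finite (simplices X (Suc k) - Y)" "finite (simplices X k - Y)"
    and surj: "boundary Y (Suc k) ` carrier (chain_space X Y (Suc k)) = carrier (chain_space X Y k)"
  shows "real_dim (homology X Y (Suc k)) + card (simplices X k - Y) = card (simplices X (Suc k) - Y)"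
proof -
  let ?C = "chain_space X Y (Suc k)"
  let ?D = "chain_space X Y k"
  let ?Z = "?C\<lparr>carrier := cycles X Y (Suc k)\<rparr>"
  interpret d: linear_map class_ring ?C ?D "boundary Y (Suc k)"
    using X by (rule linear_map_boundary)
  have ker: "d.kerT = cycles X Y (Suc k)"
    by (simp add: d.ker_def cycles_def)
  interpret Z: vectorspace class_ring ?Z
    using d.V.subspace_is_vs[OF d.kerT_is_subspace] by (simp add: ker)
  have "real_dim ?D + real_dim ?Z = real_dim ?C"
    using d.rank_nullity[OF dim_chain_space(1)[OF fin(1)]] surj
    by (simp add: ker d.im_def real_dim_def)
  moreover have "real_dim (homology X Y (Suc k)) = real_dim ?Z"
  proof -
    have empty: "simplices X (Suc (Suc k)) - Y = {}"
      using top by blast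
    have "carrier (chain_space X Y (Suc (Suc k))) = {0}"
      unfolding chain_space_def empty by simp
    then have "boundaries X Y (Suc k) = {\<zero>\<^bsub>?Z\<^esub>}"
      by (simp add: boundaries_def boundary_def)
    moreover have "Z.fin_dim"
      using d.V.fin_dim_subspace[OF d.kerT_is_subspace dim_chain_space(1)[OF fin(1)]]
      by (simp add: ker)
    ultimately show ?thesis
      using quotient_by_zero_space[OF Z.vectorspace_axioms] by (simp add: homology_def real_dim_def)
  qed
  ultimately show ?thesis
    by (simp add: dim_chain_space fin)
qed

section \<open>The star of a vertex in a graph\<close>

lemma graph_complex_no_higher_simplices: "simplices (graph_complex V E) (Suc (Suc k)) = {}"
proof -
  have "card \<sigma> \<le> 2" if "\<sigma> \<in> graph_complex V E" for \<sigma>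
    using that by (auto simp: graph_complex_def card_insert_if)
  then show ?thesis
    by (fastforce simp: simplices_def)
qed

lemma star_vertex_simplices:
  assumes G: "simple_graph V E" and v: "v \<in> V"
  defines "X \<equiv> graph_complex V E"
  shows "simplices X 0 - (X - star X {v}) = {{v}}"
    and "simplices X 1 - (X - star X {v}) = (\<lambda>w. {v, w}) ` {w \<in> V. (v, w) \<in> E}"
proof -
  show "simplices X 0 - (X - star X {v}) = {{v}}"
    using v by (auto simp: simplices_def star_def X_def graph_complex_def card_1_singleton_iff)
  have sym: "(a, b) \<in> E \<Longrightarrow> (b, a) \<in> E" and ne: "(a, b) \<in> E \<Longrightarrow> a \<noteq> b \<and> a \<in> V \<and> b \<in> V" for a b
    using G by (auto simp: simple_graph_def dest: symD irreflD)
  show "simplices X 1 - (X - star X {v}) = (\<lambda>w. {v, w}) ` {w \<in> V. (v, w) \<in> E}"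
    using ne sym
    by (fastforce simp: simplices_def star_def X_def graph_complex_def)
qed

text \<open>
  The endpoint \<open>w\<close> is killed because it lies in \<open>Y\<close>. The surviving face \<open>{v}\<close> arises by
  deleting \<open>w\<close>, which is the second vertex, with sign \<open>-1\<close>, exactly when \<open>v < w\<close>.
\<close>

lemma boundary_edge_relative:
  fixes v w :: "'a::linorder"
  assumes "v \<noteq> w" "{v} \<notin> Y" "{w} \<in> Y"
  shows "boundary Y 1 (Poly_Mapping.single {v, w} r)
    = Poly_Mapping.single {v} (if v < w then - r else r)"
proof -
  have "sorted_list_of_set {v, w} = [min v w, max v w]"
    using assms(1) by (intro sorted_list_of_set_unique[THEN iffD1]) (auto simp: min_def max_def)
  moreover have "r *\<^sub>R Poly_Mapping.single {v} s = Poly_Mapping.single {v} (r * s)" for s :: real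
    by (rule poly_mapping_eqI) (simp add: lookup_scaleR_poly_mapping lookup_single when_def)
  ultimately show ?thesis
    using assms
    by (auto simp: boundary_single face_def min_def max_def insert_Diff_if)
qed

theorem proposition27:
  fixes V :: "'a::linorder set" and E :: "('a \<times> 'a) set" and X :: "'a set set" and v :: 'a
  assumes "simple_graph V E"
    and "X = graph_complex V E"
    and "locally_finite_complex X"
    and "v \<in> V"
    and "vertex_degree V E v \<ge> 1"
  shows "local_betti X 1 (star X {v}) = real_dim (homology X (X - star X {v}) 1)
    \<and> int (real_dim (homology X (X - star X {v}) 1)) = int (vertex_degree V E v) - 1"
proof
  show "local_betti X 1 (star X {v}) = real_dim (homology X (X - star X {v}) 1)"
    by (simp add: local_betti_def)
next
  define Y where "Y = X - star X {v}"
  define N where "N = {w \<in> V. (v, w) \<in> E}"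
  have X: "simplicial_complex X"
    using assms(3) by (simp add: locally_finite_complex_def)
  have simpl0: "simplices X 0 - Y = {{v}}" and simpl1: "simplices X 1 - Y = (\<lambda>w. {v, w}) ` N"
    using star_vertex_simplices[OF assms(1,4)] by (simp_all add: Y_def N_def assms(2))
  have "card N \<ge> 1"
    using assms(5) by (simp add: vertex_degree_def N_def)
  then have "finite N" and "N \<noteq> {}"
    by (auto intro: card_ge_0_finite)
  then obtain w where w: "w \<in> N"
    by blast
  \<comment> \<open>Surjectivity rests on the existence of the neighbour \<open>w\<close>: without edges at \<open>v\<close> the image is zero.\<close>
  have "boundary Y 1 ` carrier (chain_space X Y 1) = carrier (chain_space X Y 0)"
  proof
    show "boundary Y 1 ` carrier (chain_space X Y 1) \<subseteq> carrier (chain_space X Y 0)"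
      using boundary_in_chain_space[OF X, of _ Y 0] by auto
    show "carrier (chain_space X Y 0) \<subseteq> boundary Y 1 ` carrier (chain_space X Y 1)"
    proof
      fix c assume "c \<in> carrier (chain_space X Y 0)"
      then have keys: "Poly_Mapping.keys c \<subseteq> {{v}}"
        by (simp add: carrier_chain_space simpl0)
      define r where "r = Poly_Mapping.lookup c {v}"
      have c: "c = Poly_Mapping.single {v} r"
        using keys by (auto simp: r_def lookup_single when_def in_keys_iff intro!: poly_mapping_eqI)
      have "v \<noteq> w" "{v} \<notin> Y" "{w} \<in> Y"
        using assms(1,2,4) w
        by (auto simp: N_def Y_def simple_graph_def star_def graph_complex_def dest: irreflD)
      \<comment> \<open>A multiple of a single edge reaches \<open>c\<close>; the case distinction undoes the orientation sign.\<close>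
      then have "c = boundary Y 1 (Poly_Mapping.single {v, w} (if v < w then - r else r))"
        by (simp add: boundary_edge_relative c del: One_nat_def)
      moreover have "Poly_Mapping.single {v, w} s \<in> carrier (chain_space X Y 1)" for s
        using w simpl1 by (auto simp: carrier_chain_space)
      ultimately show "c \<in> boundary Y 1 ` carrier (chain_space X Y 1)"
        by blast
    qed
  qed
  moreover have "simplices X 2 = {}"
    using graph_complex_no_higher_simplices[of V E 0] by (simp add: assms(2) numeral_2_eq_2)
  ultimately have "real_dim (homology X Y 1) + 1 = card ((\<lambda>w. {v, w}) ` N)"
    using dim_top_homology[OF X, of 0 Y] \<open>finite N\<close>
    by (simp add: simpl0 simpl1[simplified] numeral_2_eq_2)
  moreover have "inj_on (\<lambda>w. {v, w}) N"
    by (auto simp: inj_on_def doubleton_eq_iff)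
  ultimately show "int (real_dim (homology X (X - star X {v}) 1)) = int (vertex_degree V E v) - 1"
    by (simp add: card_image Y_def vertex_degree_def N_def)
qed

end
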